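(* Let $F\in C^2(\Omega)$ and let $u\in C^3([t_0,T])$ be a solution of the initial value problem $u'(t)=F(t,u(t))$, $t\in(t_0,T)$, $u(t_0)=u_0$. Suppose that there exists $\sigma>0$ such that $\kappa_\sigma'(t)=0$ for every $t\in(t_0,T)$. Let $h>0$. Suppose further that at each step $n=0,1,\ldots,N_h-1$ (with $u_n$ the value already generated by the method) the equation $$v=u_n+h\,\mathcal{C}_{\sigma}\bigl(F(t_{n+1},v),F(t_n,u_n)\bigr)$$ has a unique admissible solution $v$, where admissibility means $(t_{n+1},v)\in\Omega$. Then the specular ellipse method with $u_0=u(t_0)$ and constant scales $\sigma_n=\sigma$, i.e. the sequence in which $u_{n+1}$ is the unique admissible solution $v$ of this equation, satisfies $u_n=u(t_n)$ for every $n=0,1,\ldots,N_h$.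
   Context: Let $\Omega\subset\mathbb{R}^2$ be open, $F:\Omega\to\mathbb{R}$, $t_0\ge 0$, $T>t_0$, $u_0\in\mathbb{R}$ with $(t_0,u_0)\in\Omega$. A solution $u:[t_0,T]\to\mathbb{R}$ of the initial value problem satisfies $(t,u(t))\in\Omega$ for every $t\in[t_0,T]$. For $h>0$ put $N_h:=\lfloor h^{-1}(T-t_0)\rfloor$ and $t_n:=t_0+nh$. For $\sigma>0$ and $(\alpha,\beta)\in\mathbb{R}^2$ define $\mathcal{C}_\sigma(\alpha,\beta):=\sigma\,\mathcal{C}(\alpha/\sigma,\beta/\sigma)$, where $$\mathcal{C}(\alpha,\beta):=\left(\frac{\alpha}{\sqrt{1+\alpha^2}}+\frac{\beta}{\sqrt{1+\beta^2}}\right)\left(\frac{1}{\sqrt{1+\alpha^2}}+\frac{1}{\sqrt{1+\beta^2}}\right)^{-1}.$$ The specular ellipse method with positive scales $\{\sigma_n\}$ generates $\{u_n\}_{n=0}^{N_h}$ by the implicit update $u_{n+1}=u_n+h\,\mathcal{C}_{\sigma_n}(F(t_{n+1},u_{n+1}),F(t_n,u_n))$. For $\sigma>0$, the signed curvature of the scaled graph $\gamma_\sigma(t)=(t,u(t)/\sigma)$ is $$\kappa_\sigma(t):=\frac{\sigma^2u''(t)}{(\sigma^2+u'(t)^2)^{3/2}},\qquad t\in[t_0,T].$$ *)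

theory Defs
  imports "HOL-Analysis.Analysis"
begin

text \<open>Derivative relative to a set: one-sided at the endpoints of a closed interval.\<close>

definition deriv_within :: "real set \<Rightarrow> (real \<Rightarrow> real) \<Rightarrow> real \<Rightarrow> real" where
  "deriv_within S f t = vector_derivative f (at t within S)"

definition Ck_on :: "nat \<Rightarrow> real set \<Rightarrow> (real \<Rightarrow> real) \<Rightarrow> bool" where
  "Ck_on k S f \<longleftrightarrow>
     (\<forall>j<k. (deriv_within S ^^ j) f differentiable_on S) \<and>
     continuous_on S ((deriv_within S ^^ k) f)"

text \<open>Meant for open \<open>\<Omega>\<close>: all partial derivatives of order at most \<open>k\<close>
  exist and are continuous on \<open>\<Omega>\<close>.\<close>

primrec Ck_plane :: "nat \<Rightarrow> (real \<times> real) set \<Rightarrow> (real \<times> real \<Rightarrow> real) \<Rightarrow> bool" where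
  "Ck_plane 0 \<Omega> F \<longleftrightarrow> continuous_on \<Omega> F"
| "Ck_plane (Suc k) \<Omega> F \<longleftrightarrow>
     continuous_on \<Omega> F \<and>
     (\<exists>F1 F2.
        (\<forall>t x. (t, x) \<in> \<Omega> \<longrightarrow>
           ((\<lambda>s. F (s, x)) has_real_derivative F1 (t, x)) (at t) \<and>
           ((\<lambda>y. F (t, y)) has_real_derivative F2 (t, x)) (at x)) \<and>
        Ck_plane k \<Omega> F1 \<and> Ck_plane k \<Omega> F2)"

definition ivp_solution ::
  "(real \<times> real) set \<Rightarrow> (real \<times> real \<Rightarrow> real) \<Rightarrow> real \<Rightarrow> real \<Rightarrow> real \<Rightarrow> (real \<Rightarrow> real) \<Rightarrow> bool" where
  "ivp_solution \<Omega> F t0 T u0 u \<longleftrightarrow>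
     (\<forall>t\<in>{t0..T}. (t, u t) \<in> \<Omega>) \<and>
     (\<forall>t\<in>{t0<..<T}. (u has_real_derivative F (t, u t)) (at t)) \<and>
     u t0 = u0"

definition num_steps :: "real \<Rightarrow> real \<Rightarrow> real \<Rightarrow> nat" where
  "num_steps t0 T h = nat \<lfloor>inverse h * (T - t0)\<rfloor>"

definition grid :: "real \<Rightarrow> real \<Rightarrow> nat \<Rightarrow> real" where
  "grid t0 h n = t0 + real n * h"

definition spec_C :: "real \<Rightarrow> real \<Rightarrow> real" where
  "spec_C \<alpha> \<beta> =
     (\<alpha> / sqrt (1 + \<alpha>\<^sup>2) + \<beta> / sqrt (1 + \<beta>\<^sup>2)) *
     inverse (1 / sqrt (1 + \<alpha>\<^sup>2) + 1 / sqrt (1 + \<beta>\<^sup>2))"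

definition spec_C_scaled :: "real \<Rightarrow> real \<Rightarrow> real \<Rightarrow> real" where
  "spec_C_scaled \<sigma> \<alpha> \<beta> = \<sigma> * spec_C (\<alpha> / \<sigma>) (\<beta> / \<sigma>)"

text \<open>The value \<open>w\<close> is an admissible solution of the implicit equation for the step from
  \<open>(s, v)\<close> to time \<open>s'\<close>.\<close>

definition admissible_step ::
  "(real \<times> real) set \<Rightarrow> (real \<times> real \<Rightarrow> real) \<Rightarrow> real \<Rightarrow> real \<Rightarrow> real \<Rightarrow> real \<Rightarrow> real \<Rightarrow> real \<Rightarrow> bool" where
  "admissible_step \<Omega> F h \<sigma> s v s' w \<longleftrightarrow>
     (s', w) \<in> \<Omega> \<and> w = v + h * spec_C_scaled \<sigma> (F (s', w)) (F (s, v))"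

text \<open>Only the entries \<open>U 0, \<dots>, U (num_steps t0 T h)\<close> are constrained.\<close>

definition specular_ellipse_method ::
  "(real \<times> real) set \<Rightarrow> (real \<times> real \<Rightarrow> real) \<Rightarrow> real \<Rightarrow> real \<Rightarrow> real \<Rightarrow> real \<Rightarrow> (nat \<Rightarrow> real) \<Rightarrow>
    (nat \<Rightarrow> real) \<Rightarrow> bool" where
  "specular_ellipse_method \<Omega> F t0 T h u0 \<sigma> U \<longleftrightarrow>
     U 0 = u0 \<and>
     (\<forall>n<num_steps t0 T h. 0 < \<sigma> n \<and>
        admissible_step \<Omega> F h (\<sigma> n) (grid t0 h n) (U n) (grid t0 h (Suc n)) (U (Suc n)))"

definition scaled_curvature ::
  "real \<Rightarrow> real \<Rightarrow> real \<Rightarrow> (real \<Rightarrow> real) \<Rightarrow> real \<Rightarrow> real" where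
  "scaled_curvature t0 T \<sigma> u t =
     \<sigma>\<^sup>2 * (deriv_within {t0..T} ^^ 2) u t /
     (\<sigma>\<^sup>2 + (deriv_within {t0..T} u t)\<^sup>2) powr (3 / 2)"

end

theory Submission
  imports Defs
begin

text \<open>Let \<open>r = sqrt (\<sigma>\<^sup>2 + u'\<^sup>2)\<close>, and let \<open>S = u' / r\<close> and \<open>D = \<sigma> / r\<close> be sine and cosine of the
  inclination of the scaled graph, so \<open>S\<^sup>2 + D\<^sup>2 = 1\<close>. Then \<open>S' = \<kappa>\<close> and \<open>D' = - \<kappa> u' / \<sigma>\<close>. If
  \<open>\<kappa>\<close> is a constant, \<open>S\<close> and \<open>D\<close> are affine in \<open>t\<close> and in \<open>u\<close>; hence, for \<open>\<kappa> \<noteq> 0\<close>, the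
  difference of \<open>S\<^sup>2 + D\<^sup>2 = 1\<close> over \<open>[a, b]\<close> factors into
  \<open>(u b - u a) (D b + D a) = \<sigma> (b - a) (S b + S a)\<close>, which is the step of the method. The case
  \<open>\<kappa> = 0\<close> is that of an affine \<open>u\<close>. The exact solution is thus an admissible step, and uniqueness
  concludes.\<close>

text \<open>Multiplying each root by \<sigma> absorbs the scaling. For slopes \<alpha> and \<beta>
  of \<open>u\<close>, the two sums become sums of the sines and of the cosines of the inclinations
  of the scaled graph.\<close>

lemma spec_C_scaled_altdef:
  assumes "0 < \<sigma>"
  shows "spec_C_scaled \<sigma> \<alpha> \<beta> =
    \<sigma> * (\<alpha> / sqrt (\<sigma>\<^sup>2 + \<alpha>\<^sup>2) + \<beta> / sqrt (\<sigma>\<^sup>2 + \<beta>\<^sup>2)) / (\<sigma> / sqrt (\<sigma>\<^sup>2 + \<alpha>\<^sup>2) + \<sigma> / sqrt (\<sigma>\<^sup>2 + \<beta>\<^sup>2))"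
proof -
  have "sqrt (1 + (x / \<sigma>)\<^sup>2) = sqrt (\<sigma>\<^sup>2 + x\<^sup>2) / \<sigma>" for x
  proof -
    have "1 + (x / \<sigma>)\<^sup>2 = (\<sigma>\<^sup>2 + x\<^sup>2) / \<sigma>\<^sup>2"
      using assms by (simp add: field_simps)
    then show ?thesis
      using assms by (simp add: real_sqrt_divide)
  qed
  then show ?thesis
    using assms by (simp add: spec_C_scaled_def spec_C_def flip: divide_inverse)
qed

lemma spec_C_scaled_same: "0 < \<sigma> \<Longrightarrow> spec_C_scaled \<sigma> \<alpha> \<alpha> = \<alpha>"
proof -
  assume \<sigma>: "0 < \<sigma>"
  then have "sqrt (\<sigma>\<^sup>2 + \<alpha>\<^sup>2) > 0"
    by (simp add: add_pos_nonneg)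
  then show ?thesis
    using \<sigma> by (simp add: spec_C_scaled_altdef field_simps)
qed

text \<open>Derivatives are assumed only in the open interval and continuity on the closed one: a
  grid point may be an endpoint of the time interval, where only one-sided derivatives are at
  hand.\<close>

lemma constant_curvature_increment:
  fixes u p q :: "real \<Rightarrow> real"
  assumes "0 < \<sigma>" "a < b"
    and cont: "continuous_on {a..b} u" "continuous_on {a..b} p"
    and du: "\<And>t. a < t \<Longrightarrow> t < b \<Longrightarrow> (u has_real_derivative p t) (at t)"
    and dp: "\<And>t. a < t \<Longrightarrow> t < b \<Longrightarrow> (p has_real_derivative q t) (at t)"
    and K: "\<And>t. a < t \<Longrightarrow> t < b \<Longrightarrow> \<sigma>\<^sup>2 * q t / (\<sigma>\<^sup>2 + (p t)\<^sup>2) powr (3 / 2) = K"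
  shows "u b - u a = (b - a) * spec_C_scaled \<sigma> (p b) (p a)"
proof (cases "K = 0")
  case True
  have "q t = 0" if "a < t" "t < b" for t
    using K[OF that] True \<open>0 < \<sigma>\<close> by (auto simp: sum_power2_eq_zero_iff)
  then have p: "p t = p a" if "t \<in> {a..b}" for t
    using DERIV_isconst2[of a b p t] dp cont(2) \<open>a < b\<close> that by auto
  have "u b - p a * b = u a - p a * a"
  proof (rule DERIV_isconst_end[OF \<open>a < b\<close>])
    show "((\<lambda>t. u t - p a * t) has_real_derivative 0) (at t)" if "a < t" "t < b" for t
      using p[of t] that by (auto intro!: derivative_eq_intros du)
  qed (intro continuous_intros cont)
  \<comment> \<open>The slopes at both ends agree, and the method's average of two equal slopes is
    that slope.\<close>
  then show ?thesis
    using p[of b] \<open>a < b\<close> \<open>0 < \<sigma>\<close> by (simp add: spec_C_scaled_same algebra_simps)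
next
  case False
  define r where "r t = sqrt (\<sigma>\<^sup>2 + (p t)\<^sup>2)" for t
  define S where "S t = p t / r t" for t
  define D where "D t = \<sigma> / r t" for t
  have r_pos: "r t > 0" for t
    using \<open>0 < \<sigma>\<close> by (simp add: r_def add_pos_nonneg)
  have r2: "(r t)\<^sup>2 = \<sigma>\<^sup>2 + (p t)\<^sup>2" for t
    by (simp add: r_def)
  have cr: "continuous_on {a..b} r"
    unfolding r_def by (intro continuous_intros cont)
  have cSD: "continuous_on {a..b} S" "continuous_on {a..b} D"
    unfolding S_def D_def using r_pos by (auto intro!: continuous_intros cont cr simp: less_le)
  \<comment> \<open>Replacing the real exponent by a cube makes the curvature a rational expression
    in \<open>p\<close>, \<open>q\<close> and \<open>r\<close>.\<close>
  have powr_r: "(\<sigma>\<^sup>2 + (p t)\<^sup>2) powr (3 / 2) = r t ^ 3" for t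
  proof -
    have "(\<sigma>\<^sup>2 + (p t)\<^sup>2) powr (3 / 2) = ((r t) powr 2) powr (3 / 2)"
      using r_pos[of t] by (simp add: r2)
    also have "\<dots> = r t ^ 3"
      using r_pos[of t] unfolding powr_powr by simp
    finally show ?thesis .
  qed
  have Kr: "\<sigma>\<^sup>2 * q t / r t ^ 3 = K" if "a < t" "t < b" for t
    using K[OF that] by (simp add: powr_r)
  have dr: "(r has_real_derivative p t * q t / r t) (at t)" if "a < t" "t < b" for t
    unfolding r_def using r_pos[of t]
    by (auto intro!: derivative_eq_intros dp that simp: r_def field_simps)
  have dS: "(S has_real_derivative K) (at t)" if "a < t" "t < b" for t
  proof -
    have "(S has_real_derivative (q t * r t - p t * (p t * q t / r t)) / (r t * r t)) (at t)"
      unfolding S_def using r_pos[of t] by (intro DERIV_divide dp dr that) auto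
    \<comment> \<open>Here \<open>r\<^sup>2 - p\<^sup>2 = \<sigma>\<^sup>2\<close> turns the
      quotient rule into the curvature.\<close>
    also have "(q t * r t - p t * (p t * q t / r t)) / (r t * r t)
        = ((r t)\<^sup>2 - (p t)\<^sup>2) * q t / r t ^ 3"
      using r_pos[of t] by (simp add: field_simps power2_eq_square power3_eq_cube)
    also have "\<dots> = K"
      using Kr[OF that] by (simp add: r2)
    finally show ?thesis .
  qed
  have dD: "(D has_real_derivative - K * p t / \<sigma>) (at t)" if "a < t" "t < b" for t
  proof -
    have "(D has_real_derivative (0 * r t - \<sigma> * (p t * q t / r t)) / (r t * r t)) (at t)"
      unfolding D_def using r_pos[of t] by (intro DERIV_divide DERIV_const dr that) auto
    also have "(0 * r t - \<sigma> * (p t * q t / r t)) / (r t * r t) = - (\<sigma>\<^sup>2 * q t / r t ^ 3) * p t / \<sigma>"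
      using r_pos[of t] \<open>0 < \<sigma>\<close> by (simp add: field_simps power2_eq_square power3_eq_cube)
    finally show ?thesis
      using Kr[OF that] by simp
  qed
  have "S b - K * b = S a - K * a"
    by (rule DERIV_isconst_end[OF \<open>a < b\<close>])
       (auto intro!: continuous_intros cSD derivative_eq_intros dS)
  then have S: "S b - S a = K * (b - a)"
    by (simp add: algebra_simps)
  have "D b + K * u b / \<sigma> = D a + K * u a / \<sigma>"
    using \<open>0 < \<sigma>\<close>
    by (intro DERIV_isconst_end[OF \<open>a < b\<close>])
       (auto intro!: continuous_intros cSD cont derivative_eq_intros dD du)
  then have D: "K * (u b - u a) = - \<sigma> * (D b - D a)"
    using \<open>0 < \<sigma>\<close> by (simp add: field_simps)
  have unit: "(S t)\<^sup>2 + (D t)\<^sup>2 = 1" for t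
    using r_pos[of t] r2[of t] \<open>0 < \<sigma>\<close>
    by (simp add: S_def D_def power_divide flip: add_divide_distrib)
  have "K * ((u b - u a) * (D b + D a)) = \<sigma> * ((D a)\<^sup>2 - (D b)\<^sup>2)"
    unfolding mult.assoc[symmetric] D by (simp add: algebra_simps power2_eq_square)
  also have "(D a)\<^sup>2 - (D b)\<^sup>2 = (S b)\<^sup>2 - (S a)\<^sup>2"
    using unit[of a] unit[of b] by linarith
  also have "\<dots> = (S b - S a) * (S b + S a)"
    by (simp add: algebra_simps power2_eq_square)
  also have "\<sigma> * \<dots> = K * ((b - a) * (\<sigma> * (S b + S a)))"
    by (simp add: S)
  \<comment> \<open>Both sides carry the factor \<open>K\<close>, which cancels because it is
    nonzero in this case.\<close>
  finally have "(u b - u a) * (D b + D a) = (b - a) * (\<sigma> * (S b + S a))"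
    using False by simp
  moreover have "D b + D a > 0"
    using r_pos \<open>0 < \<sigma>\<close> by (simp add: D_def add_pos_pos)
  moreover have "spec_C_scaled \<sigma> (p b) (p a) = \<sigma> * (S b + S a) / (D b + D a)"
    using \<open>0 < \<sigma>\<close> by (simp add: spec_C_scaled_altdef S_def D_def r_def)
  ultimately show ?thesis
    by (metis less_irrefl nonzero_eq_divide_eq times_divide_eq_right)
qed

lemma deriv_within_interior:
  assumes "f differentiable_on {a..b}" "a < t" "t < b"
  shows "(f has_real_derivative deriv_within {a..b} f t) (at t)"
proof -
  have "(f has_vector_derivative deriv_within {a..b} f t) (at t within {a..b})"
    unfolding deriv_within_def using assms
    by (intro vector_derivative_works[THEN iffD1]) (auto simp: differentiable_on_def)
  then show ?thesis
    using assms by (simp add: has_real_derivative_iff_has_vector_derivative at_within_Icc_at)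
qed

lemma grid_le:
  assumes "0 < h" "t0 \<le> T" "n \<le> num_steps t0 T h"
  shows "grid t0 h n \<le> T"
proof -
  \<comment> \<open>The argument of the floor is nonnegative, so \<open>nat\<close> does not
    truncate it.\<close>
  have "real n \<le> inverse h * (T - t0)"
    using assms unfolding num_steps_def
    by (metis (no_types, opaque_lifting) diff_ge_0_iff_ge inverse_nonnegative_iff_nonnegative less_imp_le
        mult_nonneg_nonneg of_nat_floor of_nat_mono order_trans)
  then show ?thesis
    using assms by (simp add: grid_def field_simps)
qed

theorem theorem3p5:
  fixes \<Omega> :: "(real \<times> real) set" and F :: "real \<times> real \<Rightarrow> real"
    and t0 T u0 \<sigma> h :: real and u :: "real \<Rightarrow> real" and U :: "nat \<Rightarrow> real"
  assumes "open \<Omega>" and "0 \<le> t0" and "t0 < T" and "(t0, u0) \<in> \<Omega>"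
    and "Ck_plane 2 \<Omega> F"
    and "ivp_solution \<Omega> F t0 T u0 u"
    and "Ck_on 3 {t0..T} u"
    and "0 < \<sigma>"
    and "\<forall>t\<in>{t0<..<T}. (scaled_curvature t0 T \<sigma> u has_real_derivative 0) (at t)"
    and "0 < h"
    and "\<forall>n<num_steps t0 T h. \<exists>!v.
           admissible_step \<Omega> F h \<sigma> (grid t0 h n) (U n) (grid t0 h (Suc n)) v"
    and "specular_ellipse_method \<Omega> F t0 T h (u t0) (\<lambda>n. \<sigma>) U"
  shows "\<forall>n\<le>num_steps t0 T h. U n = u (grid t0 h n)"
proof -
  define p where "p = deriv_within {t0..T} u"
  define q where "q = (deriv_within {t0..T} ^^ 2) u"
  have q: "q = deriv_within {t0..T} p"
    by (simp add: q_def p_def eval_nat_numeral)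
  have diff: "(deriv_within {t0..T} ^^ j) u differentiable_on {t0..T}" if "j < 3" for j
    using assms(7) that by (auto simp: Ck_on_def)
  have diff_u: "u differentiable_on {t0..T}" and diff_p: "p differentiable_on {t0..T}"
    using diff[of 0] diff[of 1] by (auto simp: p_def)
  have cont: "continuous_on {t0..T} u" "continuous_on {t0..T} p"
    using diff_u diff_p by (auto intro: differentiable_imp_continuous_on)
  have du: "(u has_real_derivative p t) (at t)" if "t0 < t" "t < T" for t
    using deriv_within_interior[OF diff_u that] by (simp add: p_def)
  have dp: "(p has_real_derivative q t) (at t)" if "t0 < t" "t < T" for t
    using deriv_within_interior[OF diff_p that] by (simp add: q)
  have in_\<Omega>: "(t, u t) \<in> \<Omega>" if "t \<in> {t0..T}" for t
    using assms(6) that by (auto simp: ivp_solution_def)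
  \<comment> \<open>The equation is given only inside the interval, but the steps also evaluate
    \<open>F\<close> at \<open>t0\<close> and possibly at \<open>T\<close>; continuity of both terms
    extends it to the closure.\<close>
  have ode: "F (t, u t) - p t = 0" if "t \<in> {t0..T}" for t
  proof (rule continuous_constant_on_closure[where S = "{t0<..<T}" and f = "\<lambda>t. F (t, u t) - p t"])
    have "continuous_on \<Omega> F"
      using assms(5) by (simp add: eval_nat_numeral)
    then have "continuous_on {t0..T} (\<lambda>t. F (t, u t))"
      by (rule continuous_on_compose2) (auto intro!: continuous_intros cont in_\<Omega>)
    then show "continuous_on (closure {t0<..<T}) (\<lambda>t. F (t, u t) - p t)"
      using \<open>t0 < T\<close> by (auto intro!: continuous_intros cont)
    show "F (s, u s) - p s = 0" if "s \<in> {t0<..<T}" for s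
      using assms(6) that du[of s] by (auto simp: ivp_solution_def dest: DERIV_unique)
  qed (use that \<open>t0 < T\<close> in auto)
  have "\<exists>K. \<forall>t\<in>{t0<..<T}. scaled_curvature t0 T \<sigma> u t = K"
    using assms(9)
    by (intro has_field_derivative_zero_constant) (auto intro: has_field_derivative_at_within)
  then obtain K where K: "scaled_curvature t0 T \<sigma> u t = K" if "t \<in> {t0<..<T}" for t
    by blast
  have exact: "admissible_step \<Omega> F h \<sigma> (grid t0 h n) (u (grid t0 h n)) (grid t0 h (Suc n))
      (u (grid t0 h (Suc n)))" if "n < num_steps t0 T h" for n
  proof -
    let ?a = "grid t0 h n" and ?b = "grid t0 h (Suc n)"
    \<comment> \<open>The whole step stays within the time interval, so its interior lies where the
      curvature equals \<open>K\<close>.\<close>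
    have ab: "t0 \<le> ?a" "?b = ?a + h" "?b \<le> T"
      using \<open>0 < h\<close> \<open>t0 < T\<close> that grid_le[of h t0 T "Suc n"]
      by (auto simp: grid_def algebra_simps)
    have "u ?b - u ?a = (?b - ?a) * spec_C_scaled \<sigma> (p ?b) (p ?a)"
    proof (rule constant_curvature_increment[where q = q and K = K])
      show "continuous_on {?a..?b} u" "continuous_on {?a..?b} p"
        using ab by (auto intro: continuous_on_subset[OF cont(1)] continuous_on_subset[OF cont(2)])
      show "\<sigma>\<^sup>2 * q t / (\<sigma>\<^sup>2 + (p t)\<^sup>2) powr (3 / 2) = K" if "?a < t" "t < ?b" for t
        using K[of t] that ab by (simp add: scaled_curvature_def p_def q_def)
    qed (use ab \<open>0 < h\<close> \<open>0 < \<sigma>\<close> in \<open>auto intro: du dp\<close>)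
    then show ?thesis
      using ab \<open>0 < h\<close> ode[of ?a] ode[of ?b] in_\<Omega>[of ?b] by (simp add: admissible_step_def)
  qed
  have "U n = u (grid t0 h n)" if "n \<le> num_steps t0 T h" for n
    using that
  proof (induction n)
    case 0
    then show ?case
      using assms(12) by (simp add: specular_ellipse_method_def grid_def)
  next
    case (Suc n)
    then have n: "n < num_steps t0 T h" and IH: "U n = u (grid t0 h n)"
      by auto
    have "admissible_step \<Omega> F h \<sigma> (grid t0 h n) (U n) (grid t0 h (Suc n)) (U (Suc n))"
      using assms(12) n by (simp add: specular_ellipse_method_def)
    then show ?case
      \<comment> \<open>By the induction hypothesis, \<open>U (Suc n)\<close> and the exact value
        are admissible steps from the same point, so uniqueness identifies them.\<close>
      using exact[OF n] assms(11) n IH by auto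
  qed
  then show ?thesis
    by blast
qed

end
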